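(* For every integer $m\ge 0$, the generating function $F_m(x)=\sum_{n\ge0}b(n,m)x^n$ satisfies, as formal power series, $$F_m(x)=\frac{Q_m(-x)}{Q_{m+1}(x)}.$$
   Context: For a positive integer $m$, $B(m)=(b_{ij})_{1\le i,j\le m}$ is the $m\times m$ matrix with $b_{ij}=1$ if $i+j\le m+1$ and $0$ otherwise. For a square matrix $A$, $s(A)$ is the sum of all its entries. Define $b(n,m)$ for $n,m\ge0$ by $b(n,m)=1$ if $n=0$ or $m=0$, and $b(n,m)=s\big(B(m+1)^{n-1}\big)$ if $n,m\ge1$. Let $Q_0(x)=1$ and $Q_m(x)=\det(I_m-xB(m))$ for $m\ge1$. *)

theory Defs
  imports
    "Jordan_Normal_Form.Determinant"
    "HOL-Computational_Algebra.Polynomial_FPS"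
begin

text \<open>Matrix entries are indexed from 0, so row \<open>i\<close> and column \<open>j\<close> below are
  row \<open>i + 1\<close> and column \<open>j + 1\<close> in the usual 1-based numbering.\<close>

definition B :: "nat \<Rightarrow> rat mat" where
  "B m = mat m m (\<lambda>(i, j). if (i + 1) + (j + 1) \<le> m + 1 then 1 else 0)"

definition entry_sum :: "'a::comm_monoid_add mat \<Rightarrow> 'a" where
  "entry_sum A = (\<Sum>i<dim_row A. \<Sum>j<dim_col A. A $$ (i, j))"

definition b :: "nat \<Rightarrow> nat \<Rightarrow> rat" where
  "b n m = (if n = 0 \<or> m = 0 then 1 else entry_sum (B (m + 1) ^\<^sub>m (n - 1)))"

definition Q :: "nat \<Rightarrow> rat poly" where
  "Q m = (if m = 0 then 1
          else det (1\<^sub>m m - [:0, 1:] \<cdot>\<^sub>m map_mat (\<lambda>c. [:c:]) (B m)))"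

definition F :: "nat \<Rightarrow> rat fps" where
  "F m = Abs_fps (\<lambda>n. b n m)"

text \<open>The denominators have constant coefficient 1, so they are units of the ring of formal power
  series and \<open>(/)\<close> on \<^typ>\<open>rat fps\<close> is genuine division by them.\<close>

lemma coeff_0_Q: "coeff (Q m) 0 = 1"
proof (cases "m = 0")
  case True
  then show ?thesis by (simp add: Q_def)
next
  case False
  interpret h: comm_ring_hom "\<lambda>p :: rat poly. coeff p 0"
    by unfold_locales (auto simp: coeff_mult_0)
  let ?A = "1\<^sub>m m - [:0, 1:] \<cdot>\<^sub>m map_mat (\<lambda>c. [:c:]) (B m)"
  have "map_mat (\<lambda>p. coeff p 0) ?A = 1\<^sub>m m"
    by (intro eq_matI) (auto simp: B_def)
  then show ?thesis
    using False h.hom_det[of ?A] by (simp add: Q_def)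
qed

end

theory Submission
  imports Defs
begin

text \<open>
  Let \<open>B = B(m+1)\<close> and let \<open>J\<close> be the all-ones matrix of size \<open>m + 1\<close>. The series is
  \<open>F\<^sub>m(x) = 1 + x \<cdot> s((I - x B)\<^sup>-\<^sup>1)\<close>, so the matrix determinant lemma gives
  \<open>F\<^sub>m(x) \<cdot> det (I - x B) = det (I + x (J - B))\<close>. The matrix \<open>J - B\<close> vanishes in its first row and
  column, and reversing the order of the indices turns the remaining block into \<open>B(m)\<close>. Hence the
  right-hand side is \<open>Q\<^sub>m(-x)\<close>.
\<close>

text \<open>Both products of the block matrices \<open>?N\<close> and \<open>?L\<close> are block
  upper triangular with an identity block on the diagonal. Their determinants are the two sides, and
  they agree since \<open>det\<close> is multiplicative.\<close>

lemma det_one_plus_mult_commute: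
  fixes V :: "'a :: idom mat"
  assumes V: "V \<in> carrier_mat n k" and W: "W \<in> carrier_mat k n"
  shows "det (1\<^sub>m n + V * W) = det (1\<^sub>m k + W * V)"
proof -
  have VW: "V * W \<in> carrier_mat n n" and WV: "W * V \<in> carrier_mat k k"
    using V W by auto
  let ?N = "four_block_mat (1\<^sub>m n) (- V) W (1\<^sub>m k)"
  let ?L = "four_block_mat (1\<^sub>m n) (0\<^sub>m n k) (- W) (1\<^sub>m k)"
  have N: "?N \<in> carrier_mat (n + k) (n + k)" and L: "?L \<in> carrier_mat (n + k) (n + k)"
    by auto
  have "?N * ?L = four_block_mat (1\<^sub>m n + V * W) (- V) (0\<^sub>m k n) (1\<^sub>m k)"
    using V W VW by (subst mult_four_block_mat[of _ n n _ k _ k _ _ n _ k]) auto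
  then have "det (?N * ?L) = det (1\<^sub>m n + V * W)"
    using V W VW by (simp add: det_four_block_mat_lower_left_zero[where n = n and m = k])
  moreover have "?L * ?N = four_block_mat (1\<^sub>m n) (- V) (0\<^sub>m k n) (1\<^sub>m k + W * V)"
    using V W WV by (subst mult_four_block_mat[of _ n n _ k _ k _ _ n _ k])
      (auto simp: comm_add_mat[of "1\<^sub>m k" k k])
  then have "det (?L * ?N) = det (1\<^sub>m k + W * V)"
    using V W WV by (simp add: det_four_block_mat_lower_left_zero[where n = n and m = k])
  ultimately show ?thesis
    using det_mult[OF N L] det_mult[OF L N] by (simp add: mult.commute)
qed

text \<open>Writing \<open>U\<close> as \<open>W * A\<close> replaces the inverse of \<open>A\<close> that appears in the matrix determinant lemma.\<close>

lemma det_plus_mult: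
  fixes A :: "'a :: idom mat"
  assumes A: "A \<in> carrier_mat n n" and V: "V \<in> carrier_mat n k" and W: "W \<in> carrier_mat k n"
    and U: "W * A = U"
  shows "det (A + V * U) = det A * det (1\<^sub>m k + W * V)"
proof -
  have VW: "V * W \<in> carrier_mat n n"
    using V W by simp
  have "A + V * U = (1\<^sub>m n + V * W) * A"
    using A V W VW by (simp add: add_mult_distrib_mat[of _ n n] assoc_mult_mat[of _ n k _ n _ n]
        flip: U)
  then show ?thesis
    using A VW by (simp add: det_mult[of _ n] det_one_plus_mult_commute[OF V W])
qed

text \<open>Reversing rows and columns together is conjugation by the reversal permutation matrix
  \<open>?P\<close>, which is its own inverse.\<close>

lemma det_reverse:
  fixes f :: "nat \<Rightarrow> nat \<Rightarrow> 'a :: comm_ring_1"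
  shows "det (mat n n (\<lambda>(i, j). f (n - 1 - i) (n - 1 - j))) = det (mat n n (\<lambda>(i, j). f i j))"
    (is "det ?R = det ?A")
proof (rule det_similar, rule similar_matI)
  let ?P = "mat n n (\<lambda>(i, j). if j = n - 1 - i then 1 else 0) :: 'a mat"
  show "{?R, ?A, ?P, ?P} \<subseteq> carrier_mat n n" by simp
  show "?P * ?P = 1\<^sub>m n"
    by (intro eq_matI) (auto simp: scalar_prod_def mult_delta_left)
  then show "?P * ?P = 1\<^sub>m n" .
  have "?P * ?A = mat n n (\<lambda>(i, j). f (n - 1 - i) j)"
    by (intro eq_matI) (auto simp: scalar_prod_def mult_delta_left)
  moreover have "(\<Sum>l = 0..<n. f (n - 1 - i) l * (if j = n - 1 - l then 1 else 0))
      = f (n - 1 - i) (n - 1 - j)"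
    if "j < n" for i j
  proof -
    have "j = n - 1 - l \<longleftrightarrow> l = n - 1 - j" if "l < n" for l
      using that \<open>j < n\<close> by auto
    then have "(\<Sum>l = 0..<n. f (n - 1 - i) l * (if j = n - 1 - l then 1 else 0))
        = (\<Sum>l = 0..<n. if l = n - 1 - j then f (n - 1 - i) l else 0)"
      by (intro sum.cong) auto
    then show ?thesis using that by simp
  qed
  then have "mat n n (\<lambda>(i, j). f (n - 1 - i) j) * ?P = ?R"
    by (intro eq_matI) (auto simp: scalar_prod_def)
  ultimately show "?R = ?P * ?A * ?P" by simp
qed

text \<open>The matrix is block diagonal with last block 1. This pads the determinant for
  \<open>Q m\<close> to the size of \<open>B (m + 1)\<close>.\<close>

lemma det_Suc_unit_row_col:
  fixes f :: "nat \<Rightarrow> nat \<Rightarrow> 'a :: idom"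
  assumes "f n n = 1" and "\<And>i. i < n \<Longrightarrow> f i n = 0" and "\<And>i. i < n \<Longrightarrow> f n i = 0"
  shows "det (mat (Suc n) (Suc n) (\<lambda>(i, j). f i j)) = det (mat n n (\<lambda>(i, j). f i j))"
proof -
  have "mat (Suc n) (Suc n) (\<lambda>(i, j). f i j)
      = four_block_mat (mat n n (\<lambda>(i, j). f i j)) (0\<^sub>m n 1) (0\<^sub>m 1 n) (1\<^sub>m 1)"
    using assms by (intro eq_matI) (auto simp: less_Suc_eq)
  then show ?thesis
    by (simp add: det_four_block_mat_upper_right_zero[where n = n and m = 1])
qed

lemma Q_eq_det: "Q m = det (1\<^sub>m m - [:0, 1:] \<cdot>\<^sub>m map_mat (\<lambda>c. [:c:]) (B m))"
proof (cases "m = 0")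
  case True
  have "1\<^sub>m 0 - [:0, 1:] \<cdot>\<^sub>m map_mat (\<lambda>c. [:c:]) (B 0) \<in> carrier_mat 0 0"
    by (rule carrier_matI) (simp_all add: B_def)
  from det_dim_zero[OF this] show ?thesis
    using True by (simp add: Q_def)
qed (simp add: Q_def)

text \<open>A ring homomorphism commutes with \<open>det\<close>, so it can be applied entrywise.
  With indices from 0, the entry condition of \<open>B m\<close> reads
  \<open>i + j < m\<close>.\<close>

lemma fps_Q:
  "fps_of_poly (Q m) = det (mat m m (\<lambda>(i, j). of_bool (i = j) - of_bool (i + j < m) * fps_X))"
proof -
  interpret h: comm_ring_hom "fps_of_poly :: rat poly \<Rightarrow> rat fps"
    by unfold_locales (auto simp: fps_of_poly_add fps_of_poly_mult)
  show ?thesis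
    unfolding Q_eq_det h.hom_det[symmetric]
    by (intro arg_cong[where f = det] eq_matI) (auto simp: B_def fps_of_poly_diff)
qed

lemma fps_Q_pcompose_uminus:
  "fps_of_poly (Q m \<circ>\<^sub>p [:0, -1:])
    = det (mat m m (\<lambda>(i, j). of_bool (i = j) + of_bool (i + j < m) * fps_X))"
proof -
  interpret h: comm_ring_hom "\<lambda>p :: rat poly. fps_of_poly (p \<circ>\<^sub>p [:0, -1:])"
    by unfold_locales
      (auto simp: fps_of_poly_add fps_of_poly_mult pcompose_add pcompose_mult pcompose_1)
  show ?thesis
    unfolding Q_eq_det h.hom_det[symmetric]
    by (intro arg_cong[where f = det] eq_matI)
      (auto simp: B_def fps_of_poly_diff pcompose_diff pcompose_1 pcompose_pCons fps_of_poly_pCons)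
qed

text \<open>After padding by a unit row and column at index \<open>m\<close>, the reversal
  \<open>i\<close> to \<open>m - i\<close> turns \<open>i + j < m\<close> into
  \<open>m < i + j\<close>, which marks the zeros of \<open>B (m + 1)\<close>.\<close>

lemma fps_Q_pcompose_uminus_complement:
  "fps_of_poly (Q m \<circ>\<^sub>p [:0, -1:])
    = det (mat (Suc m) (Suc m) (\<lambda>(i, j). of_bool (i = j) + of_bool (m < i + j) * fps_X))"
proof -
  let ?f = "\<lambda>i j. of_bool (i = j) + of_bool (i + j < m) * fps_X :: rat fps"
  have "fps_of_poly (Q m \<circ>\<^sub>p [:0, -1:]) = det (mat (Suc m) (Suc m) (\<lambda>(i, j). ?f i j))"
    unfolding fps_Q_pcompose_uminus by (rule det_Suc_unit_row_col[symmetric]) auto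
  also have "\<dots> = det (mat (Suc m) (Suc m) (\<lambda>(i, j). ?f (Suc m - 1 - i) (Suc m - 1 - j)))"
    by (rule det_reverse[symmetric])
  also have "\<dots> = det (mat (Suc m) (Suc m) (\<lambda>(i, j). of_bool (i = j) + of_bool (m < i + j) * fps_X))"
    by (intro arg_cong[where f = det] eq_matI) auto
  finally show ?thesis .
qed

text \<open>For \<open>m = 0\<close> the matrix \<open>B 1\<close> is the 1 by 1 identity, whose
  powers have entry sum 1, in line with the convention for \<open>b n 0\<close>.\<close>

lemma b_Suc: "b (Suc n) m = entry_sum (B (Suc m) ^\<^sub>m n)"
proof (cases "m = 0")
  case True
  have "B 1 = 1\<^sub>m 1"
    by (intro eq_matI) (auto simp: B_def)
  moreover have "1\<^sub>m 1 ^\<^sub>m n = (1\<^sub>m 1 :: rat mat)"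
    by (induction n) auto
  ultimately show ?thesis
    using True by (simp add: b_def entry_sum_def)
qed (simp add: b_def)

lemma F_mult_Q: "F m * fps_of_poly (Q (Suc m)) = fps_of_poly (Q m \<circ>\<^sub>p [:0, -1:])"
proof -
  let ?n = "Suc m"
  \<comment> \<open>\<open>c k j\<close> is the sum of column \<open>j\<close> of the
    \<open>k\<close>-th power. Thus \<open>W\<close> is the all-ones row times the geometric series
    for the inverse of \<open>A\<close>, the matrix I - x B.\<close>
  define c where "c k j = (\<Sum>i<?n. (B ?n ^\<^sub>m k) $$ (i, j))" for k j
  define W where "W = mat 1 ?n (\<lambda>(i, j). Abs_fps (\<lambda>k. c k j))"
  define A :: "rat fps mat"
    where "A = mat ?n ?n (\<lambda>(i, j). of_bool (i = j) - of_bool (i + j < ?n) * fps_X)"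
  \<comment> \<open>\<open>V * U\<close> has every entry equal to \<open>fps_X\<close>, so it is the
    rank-one matrix x J.\<close>
  define U :: "rat fps mat" where "U = mat 1 ?n (\<lambda>_. 1)"
  define V :: "rat fps mat" where "V = mat ?n 1 (\<lambda>_. fps_X)"
  have carrier: "A \<in> carrier_mat ?n ?n" "V \<in> carrier_mat ?n 1" "W \<in> carrier_mat 1 ?n"
    by (auto simp: A_def V_def W_def)
  have B: "B ?n \<in> carrier_mat ?n ?n"
    by (simp add: B_def)
  note Bk = pow_carrier_mat[OF B]
  have c_0: "c 0 j = 1" if "j < ?n" for j
    using that B by (simp add: c_def del: sum.lessThan_Suc)
  have c_Suc: "c (Suc k) j = (\<Sum>l<?n. of_bool (l + j < ?n) * c k l)" if "j < ?n" for k j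
  proof -
    have "c (Suc k) j = (\<Sum>i<?n. \<Sum>l<?n. (B ?n ^\<^sub>m k) $$ (i, l) * B ?n $$ (l, j))"
      using that B Bk[of k]
      by (auto simp: c_def scalar_prod_def lessThan_atLeast0
          simp del: sum.lessThan_Suc sum.op_ivl_Suc intro!: sum.cong)
    also have "\<dots> = (\<Sum>l<?n. B ?n $$ (l, j) * c k l)"
      by (subst sum.swap) (simp add: c_def sum_distrib_left mult.commute del: sum.lessThan_Suc)
    also have "\<dots> = (\<Sum>l<?n. of_bool (l + j < ?n) * c k l)"
      using that by (intro sum.cong) (auto simp: B_def)
    finally show ?thesis .
  qed
  \<comment> \<open>This is entry \<open>j\<close> of \<open>W * A = U\<close>, read off
    coefficientwise: \<open>c_0\<close> gives the constant term, and \<open>c_Suc\<close> cancels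
    all the others.\<close>
  have inv: "Abs_fps (\<lambda>k. c k j) - fps_X * (\<Sum>l<?n. of_bool (l + j < ?n) * Abs_fps (\<lambda>k. c k l)) = 1"
    if "j < ?n" for j
  proof (rule fps_ext)
    fix k
    have *: "fps_nth (of_bool P * f) i = of_bool P * fps_nth f i" for P i and f :: "rat fps"
      by simp
    show "fps_nth (Abs_fps (\<lambda>k. c k j)
        - fps_X * (\<Sum>l<?n. of_bool (l + j < ?n) * Abs_fps (\<lambda>k. c k l))) k = fps_nth 1 k"
      by (cases k) (simp_all add: that c_0 c_Suc fps_sum_nth * del: sum.lessThan_Suc)
  qed
  have expand: "(\<Sum>l<?n. w l * (of_bool (l = j) - of_bool (l + j < ?n) * fps_X))
      = w j - fps_X * (\<Sum>l<?n. of_bool (l + j < ?n) * w l)"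
    if "j < ?n" for j and w :: "nat \<Rightarrow> rat fps"
  proof -
    have "(\<Sum>l<?n. w l * of_bool (l = j)) = w j"
      using that by (simp add: of_bool_def mult_delta_right del: sum.lessThan_Suc)
    moreover have "(\<Sum>l<?n. w l * (of_bool (l + j < ?n) * fps_X))
        = fps_X * (\<Sum>l<?n. of_bool (l + j < ?n) * w l)"
      unfolding sum_distrib_left by (intro sum.cong refl) (simp only: ac_simps)
    ultimately show ?thesis
      unfolding right_diff_distrib sum_subtractf by (rule arg_cong2)
  qed
  have "(\<Sum>l<?n. Abs_fps (\<lambda>k. c k l) * (of_bool (l = j) - of_bool (l + j < ?n) * fps_X)) = 1"
    if "j < ?n" for j
    using expand[OF that] inv[OF that] by (rule trans)
  then have "W * A = U"
    by (intro eq_matI)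
      (simp_all add: W_def A_def U_def scalar_prod_def lessThan_atLeast0
        del: sum.lessThan_Suc sum.op_ivl_Suc of_bool_eq_iff)
  from det_plus_mult[OF carrier this]
  have "det (A + V * U) = det A * det (1\<^sub>m 1 + W * V)" .
  moreover have "A + V * U = mat ?n ?n (\<lambda>(i, j). of_bool (i = j) + of_bool (m < i + j) * fps_X)"
    by (intro eq_matI) (auto simp: A_def V_def U_def scalar_prod_def)
  moreover have "det (1\<^sub>m 1 + W * V) = F m"
  proof -
    have "det (1\<^sub>m 1 + W * V) = 1 + fps_X * (\<Sum>j<?n. Abs_fps (\<lambda>k. c k j))"
      by (subst det_single)
        (auto simp: W_def V_def scalar_prod_def lessThan_atLeast0 sum_distrib_left mult.commute
          simp del: sum.lessThan_Suc sum.op_ivl_Suc)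
    also have "\<dots> = F m"
    proof (rule fps_ext)
      fix k
      \<comment> \<open>Adding up the column sums gives \<open>b (Suc k) m\<close>; the factor
        \<open>fps_X\<close> supplies the index shift and the summand 1 is
        \<open>b 0 m\<close>.\<close>
      have "entry_sum (B ?n ^\<^sub>m k) = (\<Sum>j<?n. c k j)" for k
        unfolding entry_sum_def c_def carrier_matD[OF Bk] by (rule sum.swap)
      then show "fps_nth (1 + fps_X * (\<Sum>j<?n. Abs_fps (\<lambda>k. c k j))) k = fps_nth (F m) k"
        by (cases k) (simp_all add: F_def b_Suc b_def[of 0] fps_sum_nth del: sum.lessThan_Suc)
    qed
    finally show ?thesis .
  qed
  ultimately show ?thesis
    unfolding fps_Q fps_Q_pcompose_uminus_complement A_def by (simp add: mult.commute)
qed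

theorem theorem5:
  fixes m :: nat
  shows "F m = fps_of_poly (Q m \<circ>\<^sub>p [:0, -1:]) / fps_of_poly (Q (m + 1))"
proof -
  \<comment> \<open>The constant coefficient 1 makes the denominator nonzero, so it cancels from the
    product identity.\<close>
  have "fps_of_poly (Q (Suc m)) \<noteq> 0"
    using coeff_0_Q[of "Suc m"] by auto
  then show ?thesis
    by (simp flip: F_mult_Q)
qed

end
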